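(* Let $\mathcal F$ be the collection of all non-empty subsets of $\mathbb N$, let $N\ge 2$, and let $G_1,G_2,\dots,G_N$ be simple graphs with the same set of nodes $X=\{x_1,x_2,\dots,x_n\}$, where $X$ is equipped with an arbitrary topology. Then $G_1,\dots,G_N$ are $d\mathcal F$-hypercyclic if and only if they are strongly $d\mathcal F$-hypercyclic; and $G_1,\dots,G_N$ are $d\mathcal F$-topologically transitive if and only if they are strongly $d\mathcal F$-topologically transitive.
   Context: $\mathbb N=\{1,2,3,\dots\}$. A simple graph on a finite set $X$ with $|X|>1$ is given by a symmetric relation $\rho\subseteq X\times X$ with $(x,x)\notin\rho$ for all $x$; dynamical properties of graphs $G_1,\dots,G_N$ are those of their relations $\rho_1,\dots,\rho_N$. For a relation $\rho$ on $X$, $\rho^n$ is the $n$-fold composition, $\rho^n x:=\{y:(x,y)\in\rho^n\}$, $D(\rho^n):=\{x:\rho^n x\ne\emptyset\}$, $D_\infty(\rho):=\bigcap_{n\in\mathbb N}D(\rho^n)$. Relations $\rho_1,\dots,\rho_N$ on $X$ are: - $d\mathcal F$-hypercyclic if there is $x\in\bigcap_{j=1}^N D_\infty(\rho_j)$ such that for all non-empty open $V_1,\dots,V_N\subseteq X$, $\{n\in\mathbb N:\rho_j^n x\cap V_j\neq\emptyset\text{ for all }1\le j\le N\}\in\mathcal F$; - strongly $d\mathcal F$-hypercyclic if there are $x\in X$ and elements $y_{j,n}\in\rho_j^n x$ ($1\le j\le N$, $n\in\mathbb N$) such that for all non-empty open $V_1,\dots,V_N\subseteq X$, $\{n\in\mathbb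 N:y_{j,n}\in V_j\text{ for all }1\le j\le N\}\in\mathcal F$; - $d\mathcal F$-topologically transitive if for all non-empty open $U,V_1,\dots,V_N\subseteq X$, $\{n\in\mathbb N:(\exists x\in U)\ \rho_j^n x\cap V_j\neq\emptyset\text{ for all }1\le j\le N\}\in\mathcal F$; - strongly $d\mathcal F$-topologically transitive if for all non-empty open $U,V_1,\dots,V_N\subseteq X$ there is $x\in U$ and there are elements $y_{j,n}\in\rho_j^n x$ ($1\le j\le N$, $n\in\mathbb N$) such that $\{n\in\mathbb N:y_{j,n}\in V_j\text{ for all }1\le j\le N\}\in\mathcal F$. *)

theory Defs
  imports "HOL-Analysis.Abstract_Topology"
begin

text \<open>
  The topological space \<open>X\<close> is a topology \<open>T\<close> with \<open>topspace T = X\<close>.  A family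
  \<open>\<rho>\<^sub>1, \<dots>, \<rho>\<^sub>N\<close> is a function \<open>\<rho>\<close> of which only the values at indices in \<open>{1..N}\<close> matter.
  The positive integers are \<open>{1..} :: nat set\<close>; the power \<open>\<rho> ^^ 0 = Id\<close> is never used.
\<close>

definition simple_graph_on :: "'a set \<Rightarrow> ('a \<times> 'a) set \<Rightarrow> bool" where
  "simple_graph_on X \<rho> \<longleftrightarrow>
     finite X \<and> card X > 1 \<and> \<rho> \<subseteq> X \<times> X \<and> sym \<rho> \<and> irrefl \<rho>"

definition D_infty :: "('a \<times> 'a) set \<Rightarrow> 'a set" where
  "D_infty \<rho> = (\<Inter>n\<in>{1..}. Domain (\<rho> ^^ n))"

definition open_nonempty :: "'a topology \<Rightarrow> 'a set \<Rightarrow> bool" where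
  "open_nonempty T V \<longleftrightarrow> openin T V \<and> V \<noteq> {}"

definition d_hypercyclic ::
    "nat set set \<Rightarrow> 'a topology \<Rightarrow> nat \<Rightarrow> (nat \<Rightarrow> ('a \<times> 'a) set) \<Rightarrow> bool" where
  "d_hypercyclic \<F> T N \<rho> \<longleftrightarrow>
     (\<exists>x\<in>topspace T. x \<in> (\<Inter>j\<in>{1..N}. D_infty (\<rho> j)) \<and>
        (\<forall>V. (\<forall>j\<in>{1..N}. open_nonempty T (V j)) \<longrightarrow>
           {n\<in>{1..}. \<forall>j\<in>{1..N}. (\<rho> j ^^ n) `` {x} \<inter> V j \<noteq> {}} \<in> \<F>))"

definition strongly_d_hypercyclic ::
    "nat set set \<Rightarrow> 'a topology \<Rightarrow> nat \<Rightarrow> (nat \<Rightarrow> ('a \<times> 'a) set) \<Rightarrow> bool" where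
  "strongly_d_hypercyclic \<F> T N \<rho> \<longleftrightarrow>
     (\<exists>x\<in>topspace T. \<exists>y :: nat \<Rightarrow> nat \<Rightarrow> 'a.
        (\<forall>j\<in>{1..N}. \<forall>n\<in>{1..}. y j n \<in> (\<rho> j ^^ n) `` {x}) \<and>
        (\<forall>V. (\<forall>j\<in>{1..N}. open_nonempty T (V j)) \<longrightarrow>
           {n\<in>{1..}. \<forall>j\<in>{1..N}. y j n \<in> V j} \<in> \<F>))"

definition d_topologically_transitive ::
    "nat set set \<Rightarrow> 'a topology \<Rightarrow> nat \<Rightarrow> (nat \<Rightarrow> ('a \<times> 'a) set) \<Rightarrow> bool" where
  "d_topologically_transitive \<F> T N \<rho> \<longleftrightarrow>
     (\<forall>U V. open_nonempty T U \<and> (\<forall>j\<in>{1..N}. open_nonempty T (V j)) \<longrightarrow>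
        {n\<in>{1..}. \<exists>x\<in>U. \<forall>j\<in>{1..N}. (\<rho> j ^^ n) `` {x} \<inter> V j \<noteq> {}} \<in> \<F>)"

definition strongly_d_topologically_transitive ::
    "nat set set \<Rightarrow> 'a topology \<Rightarrow> nat \<Rightarrow> (nat \<Rightarrow> ('a \<times> 'a) set) \<Rightarrow> bool" where
  "strongly_d_topologically_transitive \<F> T N \<rho> \<longleftrightarrow>
     (\<forall>U V. open_nonempty T U \<and> (\<forall>j\<in>{1..N}. open_nonempty T (V j)) \<longrightarrow>
        (\<exists>x\<in>U. \<exists>y :: nat \<Rightarrow> nat \<Rightarrow> 'a.
           (\<forall>j\<in>{1..N}. \<forall>n\<in>{1..}. y j n \<in> (\<rho> j ^^ n) `` {x}) \<and>
           {n\<in>{1..}. \<forall>j\<in>{1..N}. y j n \<in> V j} \<in> \<F>))"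

end

theory Submission
  imports Defs "HOL-Library.Countable_Set" "HOL-Library.Nat_Bijection"
begin

text \<open>
  In a graph, a walk of positive length can be prolonged by going back and forth along its last
  edge, so a vertex reached at time \<open>n\<close> is reached at all times \<open>n + 2k\<close>.  Hence, along an orbit that
  meets a tuple \<open>(V\<^sub>1, \<dots>, V\<^sub>N)\<close> once, the tuple is met infinitely often, and as there are only
  finitely many tuples of open sets, a single choice of orbits can serve each of them at some time.
  For transitivity the tuple is given in advance, and it suffices that a vertex that is not isolated
  lies in the domain of all powers.
\<close>

lemma relpow_add_even:
  assumes "sym r" "(x, y) \<in> r ^^ n" "n > 0"
  shows "(x, y) \<in> r ^^ (n + 2 * k)"
proof (induction k)
  case (Suc k)
  \<comment> \<open>This is the last edge of the walk, which exists because \<open>n > 0\<close>; by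
    symmetry the detour from \<open>y\<close> to \<open>z\<close> and back costs two steps.\<close>
  obtain z where "(z, y) \<in> r"
    using assms(2,3) by (cases n) auto
  with Suc \<open>sym r\<close> show ?case
    by (auto dest: symD)
qed (use assms in simp)

text \<open>Since \<open>m > 0\<close>, some edge leaves \<open>x\<close>, and it serves as a walk
  of length one. Any longer walk from \<open>x\<close> is prolonged by stepping back along its last
  edge.\<close>

lemma sym_Domain_relpow:
  assumes "sym r" "x \<in> Domain (r ^^ m)" "m > 0"
  shows "x \<in> Domain (r ^^ n)"
proof -
  obtain y where "(x, y) \<in> r"
    using assms(2,3) by (metis DomainE gr0_conv_Suc relpow_Suc_D2)
  show ?thesis
  proof (induction n)
    case (Suc n)
    then obtain z where z: "(x, z) \<in> r ^^ n"
      by blast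
    show ?case
    proof (cases n)
      case 0
      with \<open>(x, y) \<in> r\<close> show ?thesis by auto
    next
      case (Suc n')
      with z obtain w where "(w, z) \<in> r" by auto
      with z \<open>sym r\<close> show ?thesis by (auto dest: symD)
    qed
  qed auto
qed

text \<open>The chosen points \<open>y j n\<close> put \<open>x\<close> in every
  \<open>D_infty (\<rho> j)\<close>, and the times at which they meet \<open>V\<close> are among the
  hitting times of the full images.\<close>

lemma strongly_d_hypercyclic_imp:
  assumes "strongly_d_hypercyclic \<F> T N \<rho>" and \<F>: "\<F> = {A. A \<subseteq> {1..} \<and> A \<noteq> {}}"
  shows "d_hypercyclic \<F> T N \<rho>"
proof -
  obtain x y where x: "x \<in> topspace T"
    and y: "\<And>j n. j \<in> {1..N} \<Longrightarrow> n \<in> {1..} \<Longrightarrow> y j n \<in> (\<rho> j ^^ n) `` {x}"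
    and V: "\<And>V. \<forall>j\<in>{1..N}. open_nonempty T (V j) \<Longrightarrow>
              {n\<in>{1..}. \<forall>j\<in>{1..N}. y j n \<in> V j} \<in> \<F>"
    using assms(1) unfolding strongly_d_hypercyclic_def by blast
  have "x \<in> (\<Inter>j\<in>{1..N}. D_infty (\<rho> j))"
    using y unfolding D_infty_def by blast
  moreover have "{n\<in>{1..}. \<forall>j\<in>{1..N}. (\<rho> j ^^ n) `` {x} \<inter> V j \<noteq> {}} \<in> \<F>"
    if "\<forall>j\<in>{1..N}. open_nonempty T (V j)" for V
    using V[OF that] y unfolding \<F> by blast
  ultimately show ?thesis
    using x unfolding d_hypercyclic_def by blast
qed

lemma d_hypercyclic_imp_strongly:
  assumes "d_hypercyclic \<F> T N \<rho>" and \<F>: "\<F> = {A. A \<subseteq> {1..} \<and> A \<noteq> {}}"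
    and sym: "\<And>j. j \<in> {1..N} \<Longrightarrow> sym (\<rho> j)" and fin: "finite (topspace T)"
  shows "strongly_d_hypercyclic \<F> T N \<rho>"
proof -
  obtain x where x: "x \<in> topspace T" "x \<in> (\<Inter>j\<in>{1..N}. D_infty (\<rho> j))"
    and hit: "\<And>V. \<forall>j\<in>{1..N}. open_nonempty T (V j) \<Longrightarrow>
              {n\<in>{1..}. \<forall>j\<in>{1..N}. (\<rho> j ^^ n) `` {x} \<inter> V j \<noteq> {}} \<in> \<F>"
    using assms(1) unfolding d_hypercyclic_def by blast
  \<comment> \<open>Extensional functions forget the values outside \<open>{1..N}\<close>, so that
    only finitely many tuples remain to be enumerated.\<close>
  define A where "A = ({1..N} \<rightarrow>\<^sub>E Collect (open_nonempty T))"
  have "Collect (open_nonempty T) \<subseteq> Pow (topspace T)"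
    unfolding open_nonempty_def using openin_subset by blast
  then have "finite (Collect (open_nonempty T))"
    using fin by (meson finite_Pow_iff finite_subset)
  then have A: "countable A"
    unfolding A_def by (simp add: countable_finite finite_PiE)
  \<comment> \<open>The tuple aimed at at time \<open>n\<close>. Every tuple is aimed at infinitely often at even times and
    infinitely often at odd times.\<close>
  define W where "W n = from_nat_into A (fst (prod_decode (n div 2)))" for n
  \<comment> \<open>A point of the target if it can be reached at time \<open>n\<close>, otherwise
    any reachable point; membership in \<open>D_infty (\<rho> j)\<close> provides one.\<close>
  have "\<exists>z. z \<in> (\<rho> j ^^ n) `` {x} \<and> ((\<rho> j ^^ n) `` {x} \<inter> W n j \<noteq> {} \<longrightarrow> z \<in> W n j)"
    if "j \<in> {1..N}" "n \<in> {1..}" for j n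
  proof -
    have "(\<rho> j ^^ n) `` {x} \<noteq> {}"
      using x(2) that unfolding D_infty_def by blast
    then show ?thesis by blast
  qed
  then obtain y where y: "\<And>j n. j \<in> {1..N} \<Longrightarrow> n \<in> {1..} \<Longrightarrow> y j n \<in> (\<rho> j ^^ n) `` {x}"
    and yW: "\<And>j n. j \<in> {1..N} \<Longrightarrow> n \<in> {1..} \<Longrightarrow>
               (\<rho> j ^^ n) `` {x} \<inter> W n j \<noteq> {} \<Longrightarrow> y j n \<in> W n j"
    by metis
  have "{n\<in>{1..}. \<forall>j\<in>{1..N}. y j n \<in> V j} \<in> \<F>"
    if V: "\<forall>j\<in>{1..N}. open_nonempty T (V j)" for V
  proof -
    obtain m where "m \<ge> 1" and m: "\<And>j. j \<in> {1..N} \<Longrightarrow> (\<rho> j ^^ m) `` {x} \<inter> V j \<noteq> {}"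
      using hit[OF V] unfolding \<F> by blast
    have "restrict V {1..N} \<in> A"
      using V unfolding A_def by auto
    then obtain i where i: "from_nat_into A i = restrict V {1..N}"
      using from_nat_into_surj[OF A] by blast
    \<comment> \<open>The first summand gives \<open>n\<close> the parity of \<open>m\<close>,
      needed because walks are prolonged by even amounts. The code \<open>i\<close> selects the
      target, and \<open>m\<close> as second component makes \<open>n\<close> at least
      \<open>m\<close>.\<close>
    define n where "n = m mod 2 + 2 * prod_encode (i, m)"
    have "m \<le> prod_encode (i, m)"
      by (rule le_prod_encode_2)
    \<comment> \<open>The bound on \<open>m\<close> ensures that the subtraction is not
      truncated.\<close>
    then have "n = m + 2 * (prod_encode (i, m) - m div 2)"
      unfolding n_def by presburger
    then obtain k where k: "n = m + 2 * k" ..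
    have "n div 2 = prod_encode (i, m)"
      unfolding n_def by simp
    then have W: "W n = restrict V {1..N}"
      unfolding W_def by (simp add: i)
    have "y j n \<in> V j" if j: "j \<in> {1..N}" for j
    proof -
      obtain z where "(x, z) \<in> \<rho> j ^^ m" "z \<in> V j"
        using m[OF j] by blast
      moreover from this have "(x, z) \<in> \<rho> j ^^ n"
        unfolding k using relpow_add_even sym[OF j] \<open>m \<ge> 1\<close> by fastforce
      ultimately show ?thesis
        using yW[OF j, of n] W j \<open>m \<ge> 1\<close> k by auto
    qed
    with \<open>m \<ge> 1\<close> k have "n \<in> {n\<in>{1..}. \<forall>j\<in>{1..N}. y j n \<in> V j}"
      by simp
    then show ?thesis
      unfolding \<F> by blast
  qed
  with x(1) y show ?thesis
    unfolding strongly_d_hypercyclic_def by blast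
qed

lemma strongly_d_topologically_transitive_imp:
  assumes "strongly_d_topologically_transitive \<F> T N \<rho>"
    and \<F>: "\<F> = {A. A \<subseteq> {1..} \<and> A \<noteq> {}}"
  shows "d_topologically_transitive \<F> T N \<rho>"
  unfolding d_topologically_transitive_def
proof (intro allI impI)
  fix U V
  assume "open_nonempty T U \<and> (\<forall>j\<in>{1..N}. open_nonempty T (V j))"
  then obtain x y where "x \<in> U"
    and y: "\<forall>j\<in>{1..N}. \<forall>n\<in>{1..}. y j n \<in> (\<rho> j ^^ n) `` {x}"
    and "{n\<in>{1..}. \<forall>j\<in>{1..N}. y j n \<in> V j} \<in> \<F>"
    using assms(1)[unfolded strongly_d_topologically_transitive_def, rule_format, of U V] by blast
  then obtain n where "n \<in> {1..}" "\<forall>j\<in>{1..N}. y j n \<in> V j"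
    unfolding \<F> by blast
  with \<open>x \<in> U\<close> y have "n \<in> {n\<in>{1..}. \<exists>x\<in>U. \<forall>j\<in>{1..N}. (\<rho> j ^^ n) `` {x} \<inter> V j \<noteq> {}}"
    by blast
  then show "{n\<in>{1..}. \<exists>x\<in>U. \<forall>j\<in>{1..N}. (\<rho> j ^^ n) `` {x} \<inter> V j \<noteq> {}} \<in> \<F>"
    unfolding \<F> by blast
qed

text \<open>One simultaneous hit at a time \<open>m\<close> suffices for \<open>\<F>\<close>, so the
  sequences are prescribed only at \<open>m\<close>; elsewhere they merely have to exist.\<close>

lemma d_topologically_transitive_imp_strongly:
  assumes "d_topologically_transitive \<F> T N \<rho>" and \<F>: "\<F> = {A. A \<subseteq> {1..} \<and> A \<noteq> {}}"
    and sym: "\<And>j. j \<in> {1..N} \<Longrightarrow> sym (\<rho> j)"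
  shows "strongly_d_topologically_transitive \<F> T N \<rho>"
  unfolding strongly_d_topologically_transitive_def
proof (intro allI impI)
  fix U V
  assume "open_nonempty T U \<and> (\<forall>j\<in>{1..N}. open_nonempty T (V j))"
  then have "{n\<in>{1..}. \<exists>x\<in>U. \<forall>j\<in>{1..N}. (\<rho> j ^^ n) `` {x} \<inter> V j \<noteq> {}} \<in> \<F>"
    using assms(1) unfolding d_topologically_transitive_def by meson
  then obtain m x where m: "m \<in> {1..}" and "x \<in> U"
    and hit: "\<forall>j\<in>{1..N}. (\<rho> j ^^ m) `` {x} \<inter> V j \<noteq> {}"
    unfolding \<F> by blast
  have "\<exists>z. z \<in> (\<rho> j ^^ n) `` {x} \<and> (n = m \<longrightarrow> z \<in> V j)" if j: "j \<in> {1..N}" for j n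
  proof (cases "n = m")
    case False
    have "x \<in> Domain (\<rho> j ^^ m)"
      using hit j by blast
    then have "x \<in> Domain (\<rho> j ^^ n)"
      using sym_Domain_relpow sym[OF j] m by fastforce
    with False show ?thesis by blast
  qed (use hit j in blast)
  then obtain y where y: "\<And>j n. j \<in> {1..N} \<Longrightarrow> y j n \<in> (\<rho> j ^^ n) `` {x}"
    and "\<And>j. j \<in> {1..N} \<Longrightarrow> y j m \<in> V j"
    by metis
  with m have "m \<in> {n\<in>{1..}. \<forall>j\<in>{1..N}. y j n \<in> V j}"
    by blast
  then have "{n\<in>{1..}. \<forall>j\<in>{1..N}. y j n \<in> V j} \<in> \<F>"
    unfolding \<F> by blast
  with \<open>x \<in> U\<close> y show "\<exists>x\<in>U. \<exists>y. (\<forall>j\<in>{1..N}. \<forall>n\<in>{1..}. y j n \<in> (\<rho> j ^^ n) `` {x}) \<and>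
      {n\<in>{1..}. \<forall>j\<in>{1..N}. y j n \<in> V j} \<in> \<F>"
    by blast
qed

theorem proposition3p5:
  fixes X :: "'a set" and T :: "'a topology"
    and N :: nat and \<rho> :: "nat \<Rightarrow> ('a \<times> 'a) set"
    and \<F> :: "nat set set"
  assumes "\<F> = {A. A \<subseteq> {1..} \<and> A \<noteq> {}}"
    and "N \<ge> 2"
    and "\<forall>j\<in>{1..N}. simple_graph_on X (\<rho> j)"
    and "topspace T = X"
  shows "(d_hypercyclic \<F> T N \<rho> \<longleftrightarrow> strongly_d_hypercyclic \<F> T N \<rho>) \<and>
         (d_topologically_transitive \<F> T N \<rho> \<longleftrightarrow> strongly_d_topologically_transitive \<F> T N \<rho>)"
proof -
  have sym: "sym (\<rho> j)" if "j \<in> {1..N}" for j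
    using assms(3) that unfolding simple_graph_on_def by blast
  \<comment> \<open>Finiteness of \<open>X\<close> is part of \<open>simple_graph_on\<close>, so an
    actual index is needed to extract it.\<close>
  have "1 \<in> {1..N}"
    using assms(2) by simp
  then have "finite (topspace T)"
    using assms(3,4) unfolding simple_graph_on_def by blast
  with sym show ?thesis
    using strongly_d_hypercyclic_imp[OF _ assms(1)] d_hypercyclic_imp_strongly[OF _ assms(1)]
      strongly_d_topologically_transitive_imp[OF _ assms(1)]
      d_topologically_transitive_imp_strongly[OF _ assms(1)]
    by blast
qed

end
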